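(* Let $S=(X,V_{\mathsf w},w,f)$ be a discrete-time stochastic system and let $X_0,X_1\subseteq X$ be Borel sets. Suppose there exist a measurable non-negative function $B:X\to[0,\infty)$ and constants $c\ge 0$ and $\gamma\in[0,1]$ such that \begin{align*} &B(x)\le \gamma && \text{for all } x\in X_0,\\ &B(x)\ge 1 && \text{for all } x\in X_1,\\ &B \text{ is a } c\text{-martingale for } S \text{ (on all of } X). \end{align*} Then for every $T_d\in\{0,1,2,\ldots\}$ the probability that the solution process of $S$ starting from an initial state $x(0)\in X_0$ reaches $X_1$ within the time horizon $\{0,1,\ldots,T_d\}$ is at most $\gamma+cT_d$; that is, for every $x_0\in X_0$, $$\mathbb{P}\{x(k)\in X_1 \text{ for some } 0\le k\le T_d \mid x(0)=x_0\}\le \gamma+cT_d .$$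
   Context: A discrete-time stochastic system is a tuple $S=(X,V_{\mathsf w},w,f)$, where $X$ and $V_{\mathsf w}$ are Borel spaces (the state space and the uncertainty space, with their Borel sigma-algebras), $w=\{w(k):\Omega\to V_{\mathsf w},\ k\in\{0,1,2,\ldots\}\}$ is a sequence of independent and identically distributed random variables on a probability space, and $f:X\times V_{\mathsf w}\to X$ is a measurable map. For a given initial state $x(0)\in X$, the state evolves as $x(k+1)=f(x(k),w(k))$ for $k=0,1,2,\ldots$; the resulting process is the solution process of $S$. For a constant $c\ge 0$, a function $B:X\to\mathbb{R}$ is a $c$-martingale for $S$ if $\mathbb{E}[B(x(k+1))\mid x(k)]\le B(x(k))+c$ for all $x(k)\in X$ and all $k\in\{0,1,2,\ldots\}$, where the expectation is with respect to $w(k)$; equivalently, $\mathbb{E}[B(f(x,w(k)))]\le B(x)+c$ for all $x\in X$ and all $k$. *)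

theory Defs
  imports "HOL-Probability.Probability"
begin

text \<open>
  A Borel space is a Borel subset of a Polish space, with the subspace topology and its
  Borel sigma-algebra (for a subset \<open>X\<close> this is \<open>restrict_space borel X\<close>).  Maps on
  \<open>X\<close> are total functions on the ambient type of which only the values on \<open>X\<close> matter.
\<close>

definition borel_space :: "'a :: polish_space set \<Rightarrow> 'a measure" where
  "borel_space X = restrict_space borel X"

locale stochastic_system = prob_space M
  for M :: "'o measure" +
  fixes X :: "'x :: polish_space set"
    and V :: "'v :: polish_space set"
    and w :: "nat \<Rightarrow> 'o \<Rightarrow> 'v"
    and f :: "'x \<times> 'v \<Rightarrow> 'x"
  assumes X_borel: "X \<in> sets borel"
    and V_borel: "V \<in> sets borel"
    and w_indep: "indep_vars (\<lambda>_. borel_space V) w UNIV"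
    and w_ident: "\<And>j k. distr M (borel_space V) (w j) = distr M (borel_space V) (w k)"
    and f_measurable: "f \<in> borel_space X \<Otimes>\<^sub>M borel_space V \<rightarrow>\<^sub>M borel_space X"

primrec solution :: "(nat \<Rightarrow> 'o \<Rightarrow> 'v) \<Rightarrow> ('x \<times> 'v \<Rightarrow> 'x) \<Rightarrow> 'x \<Rightarrow> nat \<Rightarrow> 'o \<Rightarrow> 'x" where
  "solution w f x0 0 \<omega> = x0"
| "solution w f x0 (Suc k) \<omega> = f (solution w f x0 k \<omega>, w k \<omega>)"

text \<open>
  The Bochner integral of a non-integrable function is 0, so that the inequality alone
  could hold vacuously; integrability is therefore demanded.  For a measurable \<open>B \<ge> 0\<close>
  it amounts to reading the expectation in \<open>[0, \<infinity>]\<close>.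
\<close>

definition c_martingale ::
  "'o measure \<Rightarrow> 'x set \<Rightarrow> (nat \<Rightarrow> 'o \<Rightarrow> 'v) \<Rightarrow> ('x \<times> 'v \<Rightarrow> 'x) \<Rightarrow> real \<Rightarrow> ('x \<Rightarrow> real) \<Rightarrow> bool" where
  "c_martingale M X w f c B \<longleftrightarrow>
     (\<forall>x\<in>X. \<forall>k. integrable M (\<lambda>\<omega>. B (f (x, w k \<omega>))) \<and>
       (\<integral>\<omega>. B (f (x, w k \<omega>)) \<partial>M) \<le> B x + c)"

lemma (in stochastic_system) solution_measurable:
  assumes "x0 \<in> X"
  shows "solution w f x0 k \<in> M \<rightarrow>\<^sub>M borel_space X"
proof (induction k)
  case 0
  have "x0 \<in> space (borel_space X)"
    using assms by (simp add: borel_space_def space_restrict_space)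
  moreover have "solution w f x0 0 = (\<lambda>_. x0)"
    by auto
  ultimately show ?case by simp
next
  case (Suc k)
  have w: "w k \<in> M \<rightarrow>\<^sub>M borel_space V"
    using w_indep by (simp add: indep_vars_def)
  have "(\<lambda>\<omega>. f (solution w f x0 k \<omega>, w k \<omega>)) \<in> M \<rightarrow>\<^sub>M borel_space X"
    by (rule measurable_compose[OF measurable_Pair[OF Suc w] f_measurable])
  moreover have "solution w f x0 (Suc k) = (\<lambda>\<omega>. f (solution w f x0 k \<omega>, w k \<omega>))"
    by auto
  ultimately show ?case by simp
qed

text \<open>\<open>measure\<close> is 0 on non-measurable sets; this rules that case out for the reachability event.\<close>

lemma (in stochastic_system) reach_event_measurable:
  assumes "x0 \<in> X" and "X1 \<in> sets (borel_space X)"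
  shows "{\<omega> \<in> space M. \<exists>k\<le>T. solution w f x0 k \<omega> \<in> X1} \<in> sets M"
proof -
  have "{\<omega> \<in> space M. \<exists>k\<le>T. solution w f x0 k \<omega> \<in> X1}
      = (\<Union>k\<le>T. solution w f x0 k -` X1 \<inter> space M)"
    by auto
  also have "\<dots> \<in> sets M"
    by (intro sets.finite_UN finite_atMost
        measurable_sets[OF solution_measurable[OF assms(1)] assms(2)])
  finally show ?thesis .
qed

end

theory Submission
  imports Defs
begin

text \<open>
  Let \<open>A n\<close> be the event that the solution has visited \<open>X1\<close> by time \<open>n\<close>.  By induction on \<open>n\<close>,
  \<open>P (A n) + E [B (x n); - A n] \<le> \<gamma> + c n\<close>.  Enlarging \<open>A n\<close> to \<open>A (Suc n)\<close> trades an
  integrand that is at least 1 on \<open>X1\<close> for the constant 1, and since both \<open>x n\<close> and \<open>A n\<close> are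
  functions of \<open>w 0, \<dots>, w (n - 1)\<close>, hence independent of \<open>w n\<close>, the martingale inequality may be
  integrated over \<open>- A n\<close> at the cost of at most \<open>c\<close>.
\<close>

text \<open>Independence makes the joint law of \<open>Y\<close> and \<open>Z\<close> the product of
  their laws, so Tonelli applies. Both marginals are then pulled back to \<open>M\<close>, giving
  two separate sample points \<open>\<omega>\<close> and \<open>\<omega>'\<close>.\<close>

lemma (in prob_space) nn_integral_indep_var:
  assumes "indep_var S Y T Z" and "F \<in> borel_measurable (S \<Otimes>\<^sub>M T)"
  shows "(\<integral>\<^sup>+\<omega>. F (Y \<omega>, Z \<omega>) \<partial>M) = (\<integral>\<^sup>+\<omega>. (\<integral>\<^sup>+\<omega>'. F (Y \<omega>, Z \<omega>') \<partial>M) \<partial>M)"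
proof -
  note [measurable] = assms(2)
  have [measurable]: "Y \<in> M \<rightarrow>\<^sub>M S" "Z \<in> M \<rightarrow>\<^sub>M T"
    and pair: "distr M S Y \<Otimes>\<^sub>M distr M T Z = distr M (S \<Otimes>\<^sub>M T) (\<lambda>\<omega>. (Y \<omega>, Z \<omega>))"
    using assms(1) by (auto simp: indep_var_distribution_eq)
  interpret Z: prob_space "distr M T Z"
    by (rule prob_space_distr) measurable
  have "(\<integral>\<^sup>+\<omega>. F (Y \<omega>, Z \<omega>) \<partial>M) = (\<integral>\<^sup>+p. F p \<partial>(distr M S Y \<Otimes>\<^sub>M distr M T Z))"
    by (simp add: pair nn_integral_distr)
  also have "\<dots> = (\<integral>\<^sup>+y. (\<integral>\<^sup>+z. F (y, z) \<partial>distr M T Z) \<partial>distr M S Y)"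
    by (rule Z.nn_integral_fst[symmetric]) simp
  also have "\<dots> = (\<integral>\<^sup>+\<omega>. (\<integral>\<^sup>+z. F (Y \<omega>, z) \<partial>distr M T Z) \<partial>M)"
    by (rule nn_integral_distr) measurable
  also have "\<dots> = (\<integral>\<^sup>+\<omega>. (\<integral>\<^sup>+\<omega>'. F (Y \<omega>, Z \<omega>') \<partial>M) \<partial>M)"
  proof (rule nn_integral_cong)
    fix \<omega> assume "\<omega> \<in> space M"
    then have "Y \<omega> \<in> space S"
      by (rule measurable_space[OF \<open>Y \<in> M \<rightarrow>\<^sub>M S\<close>])
    then show "(\<integral>\<^sup>+z. F (Y \<omega>, z) \<partial>distr M T Z) = (\<integral>\<^sup>+\<omega>'. F (Y \<omega>, Z \<omega>') \<partial>M)"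
      by (intro nn_integral_distr) measurable
  qed
  finally show ?thesis .
qed

text \<open>The solution up to time \<open>n\<close> reads only the noise at indices below
  \<open>n\<close>. Driving the system by the coordinate maps \<open>\<lambda>i v. v i\<close> makes
  it a function of the noise path, so it factors through the past.\<close>

lemma solution_restrict:
  assumes "k \<le> n"
  shows "solution (\<lambda>i v. v i) f x0 k (\<lambda>i\<in>{..<n}. w i \<omega>) = solution w f x0 k \<omega>"
  using assms by (induction k) auto

context stochastic_system
begin

lemma space_borel_space: "space (borel_space Y) = Y"
  by (simp add: borel_space_def space_restrict_space)

lemma w_measurable: "w k \<in> M \<rightarrow>\<^sub>M borel_space V"
  using w_indep by (simp add: indep_vars_def)

lemma canonical_solution_measurable:
  assumes "x0 \<in> X" and "k \<le> n"
  shows "solution (\<lambda>i v. v i) f x0 k \<in> PiM {..<n} (\<lambda>_. borel_space V) \<rightarrow>\<^sub>M borel_space X"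
  using assms(2)
proof (induction k)
  case 0
  show ?case
    using assms(1) by (simp add: space_borel_space cong: measurable_cong)
next
  case (Suc k)
  let ?s = "solution (\<lambda>i v. v i) f x0 k"
  have "(\<lambda>v. f (?s v, v k)) \<in> PiM {..<n} (\<lambda>_. borel_space V) \<rightarrow>\<^sub>M borel_space X"
    using Suc
    by (intro measurable_compose[OF measurable_Pair f_measurable] measurable_component_singleton)
       auto
  then show ?case
    by (simp cong: measurable_cong)
qed

text \<open>
  \<open>indep_var\<close> relates two variables of the same type, so the present is kept as a family over
  the singleton \<open>{n}\<close> when independence is invoked.
\<close>

lemma nn_integral_past_present:
  assumes "F \<in> borel_measurable (PiM {..<n} (\<lambda>_. borel_space V) \<Otimes>\<^sub>M borel_space V)"
  shows "(\<integral>\<^sup>+\<omega>. F (\<lambda>i\<in>{..<n}. w i \<omega>, w n \<omega>) \<partial>M)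
    = (\<integral>\<^sup>+\<omega>. (\<integral>\<^sup>+\<omega>'. F (\<lambda>i\<in>{..<n}. w i \<omega>, w n \<omega>') \<partial>M) \<partial>M)"
proof -
  let ?N = "\<lambda>A. PiM A (\<lambda>_. borel_space V)"
  have "(\<lambda>p. F (fst p, snd p n)) \<in> borel_measurable (?N {..<n} \<Otimes>\<^sub>M ?N {n})"
    by (intro measurable_compose[OF measurable_Pair assms] measurable_fst
        measurable_compose[OF measurable_snd measurable_component_singleton]) simp
  from nn_integral_indep_var[OF indep_var_restrict[OF w_indep] this] show ?thesis
    by simp
qed

text \<open>Freeze the past: \<open>A\<close> and the state at time \<open>n\<close> become
  constants, and only \<open>w n\<close> is left to integrate, which is the situation of the
  martingale inequality.\<close>

lemma nn_integral_martingale_step: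
  fixes n :: nat
  assumes x0: "x0 \<in> X" and X1: "X1 \<in> sets (borel_space X)"
    and B: "B \<in> borel_measurable (borel_space X)" "\<And>x. x \<in> X \<Longrightarrow> 0 \<le> B x"
    and mart: "c_martingale M X w f c B" and c: "0 \<le> c"
  defines "A \<equiv> {\<omega> \<in> space M. \<exists>k\<le>n. solution w f x0 k \<omega> \<in> X1}"
  shows "(\<integral>\<^sup>+\<omega>. ennreal (B (solution w f x0 (Suc n) \<omega>)) * indicator (- A) \<omega> \<partial>M)
    \<le> (\<integral>\<^sup>+\<omega>. ennreal (B (solution w f x0 n \<omega>)) * indicator (- A) \<omega> \<partial>M) + ennreal c"
proof -
  let ?N = "PiM {..<n} (\<lambda>_. borel_space V)"
  let ?s = "solution (\<lambda>i v. v i) f x0"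
  define past where "past \<omega> = (\<lambda>i\<in>{..<n}. w i \<omega>)" for \<omega>
  \<comment> \<open>\<open>D\<close> is the event \<open>A\<close> read on noise paths, and
    \<open>F\<close> below is the integrand as a function of past and present.\<close>
  define D where "D = {v. \<exists>k\<le>n. ?s k v \<in> X1}"
  define F where "F = (\<lambda>(v, u). ennreal (B (f (?s n v, u))) * indicator (- D) v)"
  note [measurable] = B(1) X1 f_measurable
  have s [measurable]: "?s k \<in> ?N \<rightarrow>\<^sub>M borel_space X" if "k \<le> n" for k
    using canonical_solution_measurable[OF x0 that] .
  have "D \<inter> space ?N = (\<Union>k\<le>n. ?s k -` X1 \<inter> space ?N)"
    by (auto simp: D_def)
  also have "\<dots> \<in> sets ?N"
    by (intro sets.finite_UN finite_atMost measurable_sets[OF s X1]) simp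
  finally have "D \<inter> space ?N \<in> sets ?N" .
  \<comment> \<open>\<open>D\<close> may contain functions outside \<open>space ?N\<close>, so the
    indicator of \<open>- D\<close> is replaced by an expression agreeing with it on that
    space.\<close>
  then have "indicator (D \<inter> space ?N) \<in> borel_measurable ?N"
    by (rule borel_measurable_indicator)
  then have "(\<lambda>v. 1 - indicator (D \<inter> space ?N) v :: ennreal) \<in> borel_measurable ?N"
    by measurable
  then have [measurable]: "(indicator (- D) :: _ \<Rightarrow> ennreal) \<in> borel_measurable ?N"
    by (rule measurable_cong[THEN iffD1, rotated]) (auto simp: indicator_def)
  have F: "F \<in> borel_measurable (?N \<Otimes>\<^sub>M borel_space V)"
    unfolding F_def using s[of n] by measurable
  have s_past: "?s k (past \<omega>) = solution w f x0 k \<omega>" if "k \<le> n" for k \<omega>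
    unfolding past_def using that by (rule solution_restrict)
  have ind_past: "indicator (- D) (past \<omega>) = (indicator (- A) \<omega> :: ennreal)"
    if "\<omega> \<in> space M" for \<omega>
    using that by (simp add: A_def D_def s_past indicator_def cong: conj_cong)
  have A: "A \<in> sets M"
    unfolding A_def by (rule reach_event_measurable[OF x0 X1])
  have sol [measurable]: "solution w f x0 k \<in> M \<rightarrow>\<^sub>M borel_space X" for k
    by (rule solution_measurable[OF x0])
  have "(\<integral>\<^sup>+\<omega>. ennreal (B (solution w f x0 (Suc n) \<omega>)) * indicator (- A) \<omega> \<partial>M)
      = (\<integral>\<^sup>+\<omega>. F (past \<omega>, w n \<omega>) \<partial>M)"
    by (rule nn_integral_cong) (simp add: F_def s_past ind_past)
  also have "\<dots> = (\<integral>\<^sup>+\<omega>. (\<integral>\<^sup>+\<omega>'. F (past \<omega>, w n \<omega>') \<partial>M) \<partial>M)"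
    by (rule nn_integral_past_present[OF F, folded past_def])
  also have "\<dots> \<le> (\<integral>\<^sup>+\<omega>. ennreal (B (solution w f x0 n \<omega>)) * indicator (- A) \<omega> + ennreal c \<partial>M)"
  proof (rule nn_integral_mono)
    fix \<omega> assume \<omega>: "\<omega> \<in> space M"
    let ?x = "solution w f x0 n \<omega>"
    have x: "?x \<in> X"
      using measurable_space[OF sol \<omega>] by (simp add: space_borel_space)
    \<comment> \<open>\<open>B\<close> is known to be nonnegative only on \<open>X\<close>, so the
      successor state must be shown to stay there.\<close>
    have nonneg: "0 \<le> B (f (?x, w n \<omega>'))" if "\<omega>' \<in> space M" for \<omega>'
    proof (rule B(2))
      show "f (?x, w n \<omega>') \<in> X"
        using measurable_space[OF f_measurable] x measurable_space[OF w_measurable that]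
        by (simp add: space_pair_measure space_borel_space)
    qed
    have int: "integrable M (\<lambda>\<omega>'. B (f (?x, w n \<omega>')))"
      and le: "(\<integral>\<omega>'. B (f (?x, w n \<omega>')) \<partial>M) \<le> B ?x + c"
      using mart x by (auto simp: c_martingale_def)
    have "(\<integral>\<^sup>+\<omega>'. F (past \<omega>, w n \<omega>') \<partial>M)
        = (\<integral>\<^sup>+\<omega>'. ennreal (B (f (?x, w n \<omega>'))) \<partial>M) * indicator (- A) \<omega>"
      using int
      by (simp add: F_def s_past ind_past[OF \<omega>] nn_integral_multc)
    \<comment> \<open>The integrability demanded by \<open>c_martingale\<close> lets the bound on
      the Bochner integral carry over to the nonnegative integral.\<close>
    also have "(\<integral>\<^sup>+\<omega>'. ennreal (B (f (?x, w n \<omega>'))) \<partial>M)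
        = ennreal (\<integral>\<omega>'. B (f (?x, w n \<omega>')) \<partial>M)"
      by (rule nn_integral_eq_integral[OF int]) (simp add: nonneg)
    also have "\<dots> \<le> ennreal (B ?x) + ennreal c"
      using le B(2)[OF x] c by (simp add: ennreal_plus[symmetric] ennreal_leI del: ennreal_plus)
    \<comment> \<open>The constant is charged on \<open>A\<close> as well, which makes its total
      cost exactly \<open>c\<close>.\<close>
    also have "(ennreal (B ?x) + ennreal c) * indicator (- A) \<omega>
        \<le> ennreal (B ?x) * indicator (- A) \<omega> + ennreal c"
      by (simp add: indicator_def)
    finally show "(\<integral>\<^sup>+\<omega>'. F (past \<omega>, w n \<omega>') \<partial>M)
        \<le> ennreal (B ?x) * indicator (- A) \<omega> + ennreal c"
      by (simp only: mult_right_mono zero_le)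
  qed
  also have "\<dots> = (\<integral>\<^sup>+\<omega>. ennreal (B (solution w f x0 n \<omega>)) * indicator (- A) \<omega> \<partial>M) + ennreal c"
    using A by (subst nn_integral_add) (auto simp: emeasure_space_1)
  finally show ?thesis .
qed

text \<open>For a fixed starting point the induction gives the bound with \<open>B x0\<close>;
  \<open>\<gamma>\<close> enters afterwards, through \<open>B x0 \<le> \<gamma>\<close>.\<close>

lemma reach_bound:
  assumes x0: "x0 \<in> X" and X1: "X1 \<in> sets (borel_space X)"
    and B: "B \<in> borel_measurable (borel_space X)" "\<And>x. x \<in> X \<Longrightarrow> 0 \<le> B x"
    and B1: "\<And>x. x \<in> X1 \<Longrightarrow> 1 \<le> B x"
    and mart: "c_martingale M X w f c B" and c: "0 \<le> c"
  shows "prob {\<omega> \<in> space M. \<exists>k\<le>n. solution w f x0 k \<omega> \<in> X1} \<le> B x0 + c * real n"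
proof -
  define A where "A n = {\<omega> \<in> space M. \<exists>k\<le>n. solution w f x0 k \<omega> \<in> X1}" for n
  have A [measurable]: "A n \<in> sets M" for n
    unfolding A_def by (rule reach_event_measurable[OF x0 X1])
  note [measurable] = B(1) solution_measurable[OF x0]
  \<comment> \<open>State time and event time are separate because the induction step passes through
    \<open>?E (Suc n) n\<close>.\<close>
  let ?E = "\<lambda>k n. \<integral>\<^sup>+\<omega>. ennreal (B (solution w f x0 k \<omega>)) * indicator (- A n) \<omega> \<partial>M"
  have "emeasure M (A n) + ?E n n \<le> ennreal (B x0 + c * real n)"
  proof (induction n)
    case 0
    show ?case
    \<comment> \<open>At time 0 the event is everything or nothing: either the sum is 1, at most
      \<open>B x0\<close>, or it equals \<open>B x0\<close>.\<close>
    proof (cases "x0 \<in> X1")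
      case True
      then have "A 0 = space M"
        by (auto simp: A_def)
      moreover have "?E 0 0 = (\<integral>\<^sup>+\<omega>. 0 \<partial>M)"
        using True by (intro nn_integral_cong) (simp add: A_def)
      ultimately show ?thesis
        using B1[OF True] by (simp add: emeasure_space_1 ennreal_leI)
    next
      case False
      then have "A 0 = {}"
        by (auto simp: A_def)
      then show ?thesis
        by (simp add: emeasure_space_1)
    qed
  next
    case (Suc n)
    have "emeasure M (A (Suc n)) + ?E (Suc n) (Suc n)
        = (\<integral>\<^sup>+\<omega>. indicator (A (Suc n)) \<omega> +
            ennreal (B (solution w f x0 (Suc n) \<omega>)) * indicator (- A (Suc n)) \<omega> \<partial>M)"
      by (subst nn_integral_add) (auto simp del: solution.simps)
    also have "\<dots> \<le> (\<integral>\<^sup>+\<omega>. indicator (A n) \<omega> +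
            ennreal (B (solution w f x0 (Suc n) \<omega>)) * indicator (- A n) \<omega> \<partial>M)"
    proof (rule nn_integral_mono)
      \<comment> \<open>The integrands differ only on paths first entering \<open>X1\<close> at time
        \<open>Suc n\<close>, where the left one is 1 and the right one is \<open>B\<close> at a
        point of \<open>X1\<close>.\<close>
      fix \<omega> assume "\<omega> \<in> space M"
      then have "\<omega> \<in> A (Suc n) \<longleftrightarrow> \<omega> \<in> A n \<or> solution w f x0 (Suc n) \<omega> \<in> X1"
        by (auto simp: A_def le_Suc_eq simp del: solution.simps)
      then show "indicator (A (Suc n)) \<omega> +
            ennreal (B (solution w f x0 (Suc n) \<omega>)) * indicator (- A (Suc n)) \<omega>
          \<le> indicator (A n) \<omega> +
            ennreal (B (solution w f x0 (Suc n) \<omega>)) * indicator (- A n) \<omega>"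
        using B1 by (auto simp: indicator_def simp del: solution.simps)
    qed
    also have "\<dots> = emeasure M (A n) + ?E (Suc n) n"
      by (subst nn_integral_add) (auto simp del: solution.simps)
    also have "\<dots> \<le> emeasure M (A n) + (?E n n + ennreal c)"
      unfolding A_def
      by (intro add_left_mono nn_integral_martingale_step[OF x0 X1 B mart c])
    also have "\<dots> \<le> ennreal (B x0 + c * real n) + ennreal c"
      using add_right_mono[OF Suc, of "ennreal c"] by (simp only: add.assoc)
    also have "\<dots> = ennreal (B x0 + c * real (Suc n))"
      using B(2)[OF x0] c by (simp add: ennreal_plus[symmetric] algebra_simps del: ennreal_plus)
    finally show ?case .
  qed
  \<comment> \<open>The nonnegative term \<open>?E n n\<close> has served the induction and is
    dropped.\<close>
  then have "emeasure M (A n) \<le> ennreal (B x0 + c * real n)"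
    by (rule order_trans[rotated]) simp
  then show ?thesis
    using B(2)[OF x0] c by (simp add: emeasure_eq_measure A_def del: ennreal_plus)
qed

end

theorem theorem1:
  fixes M :: "'o measure"
    and X X0 X1 :: "'x :: polish_space set"
    and V :: "'v :: polish_space set"
    and w :: "nat \<Rightarrow> 'o \<Rightarrow> 'v"
    and f :: "'x \<times> 'v \<Rightarrow> 'x"
    and B :: "'x \<Rightarrow> real"
    and c \<gamma> :: real
  assumes "stochastic_system M X V w f"
    and "X0 \<in> sets (borel_space X)"
    and "X1 \<in> sets (borel_space X)"
    and "B \<in> borel_measurable (borel_space X)"
    and "\<And>x. x \<in> X \<Longrightarrow> 0 \<le> B x"
    and "0 \<le> c"
    and "0 \<le> \<gamma>" "\<gamma> \<le> 1"
    and "\<And>x. x \<in> X0 \<Longrightarrow> B x \<le> \<gamma>"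
    and "\<And>x. x \<in> X1 \<Longrightarrow> 1 \<le> B x"
    and "c_martingale M X w f c B"
  shows "\<forall>T :: nat. \<forall>x0\<in>X0.
    measure M {\<omega> \<in> space M. \<exists>k\<le>T. solution w f x0 k \<omega> \<in> X1} \<le> \<gamma> + c * real T"
proof (intro allI ballI)
  fix T :: nat and x0 assume x0: "x0 \<in> X0"
  interpret stochastic_system M X V w f
    by fact
  have "x0 \<in> X"
    using sets.sets_into_space[OF assms(2)] x0 by (auto simp: space_borel_space)
  from reach_bound[OF this assms(3-5) assms(10,11,6), of T] assms(9)[OF x0]
  show "prob {\<omega> \<in> space M. \<exists>k\<le>T. solution w f x0 k \<omega> \<in> X1} \<le> \<gamma> + c * real T"
    by simp
qed

end
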